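(* Let $R$ be a commutative ring with identity $1\neq 0$ and let $I$ be an ideal of $R$ such that $I\setminus \mathrm{Nil}(R)\neq\emptyset$. Then $\overline{\Gamma}(R\Join I)=\Gamma(R\Join I)$ if and only if both of the following assertions hold: (1) $\overline{\Gamma}(R)=\Gamma(R)$; (2) $I\subseteq \mathrm{Ann}(\mathrm{Nil}(R))$.
   Context: For a commutative ring $A$ with $1\neq 0$, $Z(A)$ is the set of zero-divisors of $A$ (including $0$), $Z(A)^*=Z(A)\setminus\{0\}$, and $\mathrm{Nil}(A)$ is the set of nilpotent elements of $A$. For $X\subseteq A$, $\mathrm{Ann}(X)=\{y\in A : xy=0 \text{ for all } x\in X\}$. The zero-divisor graph $\Gamma(A)$ is the simple graph with vertex set $Z(A)^*$ in which distinct vertices $x,y$ are adjacent if and only if $xy=0$. The extended zero-divisor graph $\overline{\Gamma}(A)$ is the simple graph with the same vertex set $Z(A)^*$ in which distinct vertices $x,y$ are adjacent if and only if there exist integers $n,m\geq 1$ with $x^ny^m=0$, $x^n\neq 0$ and $y^m\neq 0$. Equality of two graphs on the same vertex set means that they have the same edges. For an ideal $I$ of $R$, the amalgamated duplication of $R$ along $I$ is the subring $R\Join I=\{(r,r+i) : r\in R,\ i\in I\}$ of $R\times R$. *)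

theory Defs
  imports "HOL-Algebra.Algebra" "Graph_Theory.Pair_Digraph"
begin

definition zero_divisors :: "('a, 'b) ring_scheme \<Rightarrow> 'a set"
  where "zero_divisors A =
    {x \<in> carrier A. \<exists>y \<in> carrier A. y \<noteq> \<zero>\<^bsub>A\<^esub> \<and> x \<otimes>\<^bsub>A\<^esub> y = \<zero>\<^bsub>A\<^esub>}"

definition nilpotents :: "('a, 'b) ring_scheme \<Rightarrow> 'a set"
  where "nilpotents A = {x \<in> carrier A. \<exists>n::nat. n \<ge> 1 \<and> x [^]\<^bsub>A\<^esub> n = \<zero>\<^bsub>A\<^esub>}"

definition annihilator :: "('a, 'b) ring_scheme \<Rightarrow> 'a set \<Rightarrow> 'a set"
  where "annihilator A S = {y \<in> carrier A. \<forall>x \<in> S. x \<otimes>\<^bsub>A\<^esub> y = \<zero>\<^bsub>A\<^esub>}"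

text \<open>
  Simple graphs, possibly infinite, are represented by loop-free symmetric digraphs without
  parallel arcs: the edge between \<open>x\<close> and \<open>y\<close> is the pair of arcs \<open>(x, y)\<close>, \<open>(y, x)\<close>. Equality of
  two such records with the same vertex set is equality of the edge sets.
\<close>

definition zero_divisor_graph :: "('a, 'b) ring_scheme \<Rightarrow> 'a pair_pre_digraph"
  where "zero_divisor_graph A =
    (let V = zero_divisors A - {\<zero>\<^bsub>A\<^esub>} in
     \<lparr> pverts = V,
       parcs = {(x, y). x \<in> V \<and> y \<in> V \<and> x \<noteq> y \<and> x \<otimes>\<^bsub>A\<^esub> y = \<zero>\<^bsub>A\<^esub>} \<rparr>)"

definition extended_zero_divisor_graph :: "('a, 'b) ring_scheme \<Rightarrow> 'a pair_pre_digraph"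
  where "extended_zero_divisor_graph A =
    (let V = zero_divisors A - {\<zero>\<^bsub>A\<^esub>} in
     \<lparr> pverts = V,
       parcs = {(x, y). x \<in> V \<and> y \<in> V \<and> x \<noteq> y \<and>
         (\<exists>(n::nat) (m::nat). n \<ge> 1 \<and> m \<ge> 1 \<and>
            (x [^]\<^bsub>A\<^esub> n) \<otimes>\<^bsub>A\<^esub> (y [^]\<^bsub>A\<^esub> m) = \<zero>\<^bsub>A\<^esub> \<and>
            x [^]\<^bsub>A\<^esub> n \<noteq> \<zero>\<^bsub>A\<^esub> \<and> y [^]\<^bsub>A\<^esub> m \<noteq> \<zero>\<^bsub>A\<^esub>)} \<rparr>)"

definition amalgamated_duplication :: "('a, 'b) ring_scheme \<Rightarrow> 'a set \<Rightarrow> ('a \<times> 'a) ring"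
    (infixl \<open>\<Join>\<close> 65)
  where "R \<Join> I =
    (RDirProd R R) \<lparr> carrier := {(r, r \<oplus>\<^bsub>R\<^esub> i) | r i. r \<in> carrier R \<and> i \<in> I} \<rparr>"

lemma (in cring) zero_divisor_graph_simple:
  "pair_loopfree_digraph (zero_divisor_graph R)"
  "sym (parcs (zero_divisor_graph R))"
proof -
  show "pair_loopfree_digraph (zero_divisor_graph R)"
    by unfold_locales (auto simp: zero_divisor_graph_def Let_def)
  show "sym (parcs (zero_divisor_graph R))"
  proof (rule symI)
    fix x y assume xy: "(x, y) \<in> parcs (zero_divisor_graph R)"
    then have "x \<in> carrier R" "y \<in> carrier R"
      by (auto simp: zero_divisor_graph_def Let_def zero_divisors_def)
    then have "y \<otimes> x = x \<otimes> y"
      by (rule m_comm[symmetric])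
    then show "(y, x) \<in> parcs (zero_divisor_graph R)"
      using xy by (auto simp: zero_divisor_graph_def Let_def)
  qed
qed

lemma (in cring) extended_zero_divisor_graph_simple:
  "pair_loopfree_digraph (extended_zero_divisor_graph R)"
  "sym (parcs (extended_zero_divisor_graph R))"
proof -
  show "pair_loopfree_digraph (extended_zero_divisor_graph R)"
    by unfold_locales (auto simp: extended_zero_divisor_graph_def Let_def)
  show "sym (parcs (extended_zero_divisor_graph R))"
  proof (rule symI)
    fix x y assume xy: "(x, y) \<in> parcs (extended_zero_divisor_graph R)"
    then have "x \<in> carrier R" "y \<in> carrier R"
      by (auto simp: extended_zero_divisor_graph_def Let_def zero_divisors_def)
    then have "y [^] m \<otimes> x [^] n = x [^] n \<otimes> y [^] m" for n m :: nat
      by (intro m_comm nat_pow_closed)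
    then show "(y, x) \<in> parcs (extended_zero_divisor_graph R)"
      using xy by (simp add: extended_zero_divisor_graph_def Let_def) blast
  qed
qed

lemma (in cring) amalgamated_duplication_subcring:
  assumes "ideal I R"
  shows "subcring (carrier (R \<Join> I)) (RDirProd R R)"
proof -
  interpret I: ideal I R by fact
  let ?P = "RDirProd R R"
  have car: "carrier (R \<Join> I) = {(r, s). r \<in> carrier R \<and> s \<in> carrier R \<and> s \<ominus> r \<in> I}"
  proof -
    have "r \<oplus> i \<ominus> r = i" if "r \<in> carrier R" "i \<in> carrier R" for r i
      using that by algebra
    moreover have "s = r \<oplus> (s \<ominus> r)" if "r \<in> carrier R" "s \<in> carrier R" for r s
      using that by algebra
    ultimately show ?thesis
      by (fastforce simp: amalgamated_duplication_def)
  qed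
  interpret P: ring ?P
    by (rule RDirProd_ring) (rule ring_axioms)+
  have sums: "fst (x \<oplus>\<^bsub>?P\<^esub> y) = fst x \<oplus> fst y" "snd (x \<oplus>\<^bsub>?P\<^esub> y) = snd x \<oplus> snd y"
    "fst (x \<otimes>\<^bsub>?P\<^esub> y) = fst x \<otimes> fst y" "snd (x \<otimes>\<^bsub>?P\<^esub> y) = snd x \<otimes> snd y" for x y
    by (auto simp: RDirProd_def DirProd_def monoid.defs split: prod.splits)
  have units: "\<one>\<^bsub>?P\<^esub> = (\<one>, \<one>)" "\<zero>\<^bsub>?P\<^esub> = (\<zero>, \<zero>)"
    by (auto simp: RDirProd_def DirProd_def monoid.defs)
  have uminus: "\<ominus>\<^bsub>?P\<^esub> (r, s) = (\<ominus> r, \<ominus> s)" if "r \<in> carrier R" "s \<in> carrier R" for r s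
    by (rule P.minus_equality)
      (use that in \<open>auto simp: RDirProd_carrier prod_eq_iff sums units l_neg\<close>)
  have diffs: "s \<oplus> s' \<ominus> (r \<oplus> r') = (s \<ominus> r) \<oplus> (s' \<ominus> r')"
    "s \<otimes> s' \<ominus> r \<otimes> r' = (s \<ominus> r) \<otimes> s' \<oplus> r \<otimes> (s' \<ominus> r')"
    "\<ominus> s \<ominus> \<ominus> r = \<ominus> (s \<ominus> r)"
    if "r \<in> carrier R" "s \<in> carrier R" "r' \<in> carrier R" "s' \<in> carrier R" for r s r' s'
    using that by algebra+
  show ?thesis
  proof (rule P.subcringI[OF P.subringI])
    show "carrier (R \<Join> I) \<subseteq> carrier ?P"
      by (auto simp: car RDirProd_carrier)
    show "\<one>\<^bsub>?P\<^esub> \<in> carrier (R \<Join> I)"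
      by (simp add: car units r_neg minus_eq)
    show "\<ominus>\<^bsub>?P\<^esub> h \<in> carrier (R \<Join> I)" if "h \<in> carrier (R \<Join> I)" for h
      using that by (auto simp: car uminus diffs)
    show "h \<otimes>\<^bsub>?P\<^esub> h' \<in> carrier (R \<Join> I)"
      if "h \<in> carrier (R \<Join> I)" "h' \<in> carrier (R \<Join> I)" for h h'
      using that by (auto simp: car case_prod_beta sums diffs I.I_l_closed I.I_r_closed)
    show "h \<oplus>\<^bsub>?P\<^esub> h' \<in> carrier (R \<Join> I)"
      if "h \<in> carrier (R \<Join> I)" "h' \<in> carrier (R \<Join> I)" for h h'
      using that by (auto simp: car case_prod_beta sums diffs)
    show "h \<otimes>\<^bsub>?P\<^esub> h' = h' \<otimes>\<^bsub>?P\<^esub> h"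
      if "h \<in> carrier (R \<Join> I)" "h' \<in> carrier (R \<Join> I)" for h h'
      using that by (auto simp: car prod_eq_iff sums m_comm)
  qed
qed

end

theory Submission
  imports Defs
begin

text \<open>
  Equality of the two graphs means that \<open>x\<^sup>n y\<^sup>m = 0\<close> with \<open>x\<^sup>n, y\<^sup>m \<noteq> 0\<close> and \<open>x \<noteq> y\<close> forces
  \<open>x y = 0\<close>. For the direct implication, condition (1) is read off on the diagonal. For (2), let
  \<open>b\<close> be nilpotent, \<open>0 \<noteq> a \<in> I\<close>, and let \<open>i \<in> I\<close> be non-nilpotent: a high power of
  \<open>(b, b + i)\<close> is nonzero with first component \<open>0\<close>, so it annihilates \<open>(a, 0)\<close>; hence \<open>b a = 0\<close>.

  For the converse, (1) and (2) give \<open>Nil(R)\<^sup>2 = 0\<close>: for nilpotent \<open>u, v\<close> one has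
  \<open>(u + i)\<^sup>k = u\<^sup>k + i\<^sup>k\<close> because \<open>u i = 0\<close>, so \<open>(u + i)\<^sup>k v = 0\<close> for large \<open>k\<close>, whence
  \<open>u v = (u + i) v = 0\<close>. A pair of elements of \<open>R \<Join> I\<close> is then treated componentwise; the only
  delicate case is a component with one nilpotent and one non-nilpotent entry, and there the same trick
  \<open>(u + i)\<^sup>k = u\<^sup>k + i\<^sup>k\<close> transfers the relation from the other component.
\<close>

definition powers_determine_annihilation :: "('a, 'b) ring_scheme \<Rightarrow> bool"
  where "powers_determine_annihilation A \<longleftrightarrow>
    (\<forall>x \<in> carrier A. \<forall>y \<in> carrier A. \<forall>(n::nat) (m::nat).
      x \<noteq> y \<longrightarrow> (x [^]\<^bsub>A\<^esub> n) \<otimes>\<^bsub>A\<^esub> (y [^]\<^bsub>A\<^esub> m) = \<zero>\<^bsub>A\<^esub> \<longrightarrow>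
      x [^]\<^bsub>A\<^esub> n \<noteq> \<zero>\<^bsub>A\<^esub> \<longrightarrow> y [^]\<^bsub>A\<^esub> m \<noteq> \<zero>\<^bsub>A\<^esub> \<longrightarrow> x \<otimes>\<^bsub>A\<^esub> y = \<zero>\<^bsub>A\<^esub>)"

lemma powers_determine_annihilationD:
  fixes n m :: nat
  assumes "powers_determine_annihilation A" "x \<in> carrier A" "y \<in> carrier A" "x \<noteq> y"
    and "(x [^]\<^bsub>A\<^esub> n) \<otimes>\<^bsub>A\<^esub> (y [^]\<^bsub>A\<^esub> m) = \<zero>\<^bsub>A\<^esub>"
    and "x [^]\<^bsub>A\<^esub> n \<noteq> \<zero>\<^bsub>A\<^esub>" "y [^]\<^bsub>A\<^esub> m \<noteq> \<zero>\<^bsub>A\<^esub>"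
  shows "x \<otimes>\<^bsub>A\<^esub> y = \<zero>\<^bsub>A\<^esub>"
  using assms unfolding powers_determine_annihilation_def by blast

context cring
begin

lemma zero_divisor_if_pow_mult_eq_zero:
  fixes n :: nat
  assumes "x \<in> carrier R" "z \<in> carrier R" "z \<noteq> \<zero>" "x [^] n \<otimes> z = \<zero>"
  shows "x \<in> zero_divisors R"
  using assms(2-)
proof (induction n arbitrary: z)
  case 0
  then show ?case by simp
next
  case (Suc n)
  show ?case
  proof (cases "x \<otimes> z = \<zero>")
    case True
    then show ?thesis using Suc.prems assms(1) by (auto simp: zero_divisors_def)
  next
    case False
    then show ?thesis using Suc.prems assms(1) by (intro Suc.IH[of "x \<otimes> z"]) (auto simp: m_assoc)
  qed
qed

lemma graphs_eq_iff_powers_determine_annihilation: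
  "extended_zero_divisor_graph R = zero_divisor_graph R \<longleftrightarrow> powers_determine_annihilation R"
proof
  assume eq: "extended_zero_divisor_graph R = zero_divisor_graph R"
  show "powers_determine_annihilation R"
    unfolding powers_determine_annihilation_def
  proof (intro ballI allI impI)
    fix x y and n m :: nat
    assume x: "x \<in> carrier R" and y: "y \<in> carrier R" and "x \<noteq> y"
      and xy: "x [^] n \<otimes> y [^] m = \<zero>" and xn: "x [^] n \<noteq> \<zero>" and ym: "y [^] m \<noteq> \<zero>"
    have n: "n \<ge> 1" and m: "m \<ge> 1"
      using xy xn ym x y by (cases n; cases m; force)+
    have "x \<noteq> \<zero>" "y \<noteq> \<zero>"
      using xn ym n m by (auto simp: nat_pow_zero)
    moreover have "x \<in> zero_divisors R"
      using zero_divisor_if_pow_mult_eq_zero[of x "y [^] m" n] x y xy ym by simp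
    moreover have "y \<in> zero_divisors R"
      using zero_divisor_if_pow_mult_eq_zero[of y "x [^] n" m] x y xy xn by (simp add: m_comm)
    ultimately have "(x, y) \<in> parcs (extended_zero_divisor_graph R)"
      using \<open>x \<noteq> y\<close> n m xy xn ym
      by (auto simp: extended_zero_divisor_graph_def Let_def)
    then show "x \<otimes> y = \<zero>"
      unfolding eq by (simp add: zero_divisor_graph_def Let_def)
  qed
next
  assume P: "powers_determine_annihilation R"
  have "\<exists>(n::nat) (m::nat). n \<ge> 1 \<and> m \<ge> 1 \<and> x [^] n \<otimes> y [^] m = \<zero> \<and> x [^] n \<noteq> \<zero> \<and> y [^] m \<noteq> \<zero>"
    if "x \<in> carrier R" "y \<in> carrier R" "x \<noteq> \<zero>" "y \<noteq> \<zero>" "x \<otimes> y = \<zero>" for x y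
    using that by (intro exI[of _ 1]) simp
  then show "extended_zero_divisor_graph R = zero_divisor_graph R"
    using powers_determine_annihilationD[OF P]
    by (auto simp: extended_zero_divisor_graph_def zero_divisor_graph_def Let_def zero_divisors_def)
qed

lemma add_pow_eq_pow_plus_mult:
  fixes n :: nat
  assumes "b \<in> carrier R" "c \<in> carrier R"
  shows "\<exists>w \<in> carrier R. (b \<oplus> c) [^] n = b [^] n \<oplus> c \<otimes> w"
proof (induction n)
  case 0
  then show ?case using assms by (intro bexI[of _ \<zero>]) auto
next
  case (Suc n)
  then obtain w where w: "w \<in> carrier R" "(b \<oplus> c) [^] n = b [^] n \<oplus> c \<otimes> w" by blast
  have "(b [^] n \<oplus> c \<otimes> w) \<otimes> (b \<oplus> c) =
      b [^] n \<otimes> b \<oplus> c \<otimes> (b [^] n \<oplus> w \<otimes> (b \<oplus> c))"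
    if "b [^] n \<in> carrier R"
    using that assms w(1) by algebra
  then show ?case
    using assms w by (intro bexI[of _ "b [^] n \<oplus> w \<otimes> (b \<oplus> c)"]) auto
qed

lemma nilpotents_add:
  assumes "b \<in> nilpotents R" "c \<in> nilpotents R"
  shows "b \<oplus> c \<in> nilpotents R"
proof -
  obtain k l :: nat where b: "b \<in> carrier R" "k \<ge> 1" "b [^] k = \<zero>"
    and c: "c \<in> carrier R" "l \<ge> 1" "c [^] l = \<zero>"
    using assms by (auto simp: nilpotents_def)
  obtain w where w: "w \<in> carrier R" "(b \<oplus> c) [^] k = b [^] k \<oplus> c \<otimes> w"
    using add_pow_eq_pow_plus_mult b c by blast
  have "(b \<oplus> c) [^] (k * l) = (c \<otimes> w) [^] l"
    using b c w by (simp flip: nat_pow_pow)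
  also have "\<dots> = \<zero>"
    using c w by (simp add: nat_pow_distrib)
  finally show ?thesis
    using b c by (auto simp: nilpotents_def intro!: exI[of _ "k * l"])
qed

lemma nilpotents_uminus:
  assumes "b \<in> nilpotents R"
  shows "\<ominus> b \<in> nilpotents R"
proof -
  obtain k :: nat where b: "b \<in> carrier R" "k \<ge> 1" "b [^] k = \<zero>"
    using assms by (auto simp: nilpotents_def)
  have "\<ominus> b = \<ominus> \<one> \<otimes> b" using b by algebra
  then have "(\<ominus> b) [^] k = \<zero>" using b by (simp add: nat_pow_distrib)
  then show ?thesis using b by (auto simp: nilpotents_def)
qed

lemma nilpotentI_of_pow_mult:
  fixes n m :: nat
  assumes "\<one> \<noteq> \<zero>" "x \<in> carrier R" "x [^] n \<otimes> x [^] m = \<zero>"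
  shows "x \<in> nilpotents R"
proof -
  have "x [^] (n + m) = \<zero>" using assms by (simp add: nat_pow_mult)
  moreover from this have "n + m \<ge> 1" using assms(1) by (cases "n + m") auto
  ultimately show ?thesis using assms(2) unfolding nilpotents_def by blast
qed

lemma pow_nonzero_if_not_nilpotent:
  fixes n :: nat
  assumes "\<one> \<noteq> \<zero>" "x \<in> carrier R" "x \<notin> nilpotents R"
  shows "x [^] n \<noteq> \<zero>"
  using nilpotentI_of_pow_mult[of x n 0] assms by auto

lemma add_pow_of_orthogonal:
  fixes n :: nat
  assumes "u \<in> carrier R" "i \<in> carrier R" "u \<otimes> i = \<zero>" "n \<ge> 1"
  shows "(u \<oplus> i) [^] n = u [^] n \<oplus> i [^] n"
  using assms(4)
proof (induction n rule: dec_induct)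
  case base
  then show ?case using assms by simp
next
  case (step n)
  obtain k where n: "n = Suc k" using step by (cases n) auto
  have un: "u [^] n \<otimes> i = \<zero>" using assms by (simp add: n m_assoc)
  have ni: "i [^] n \<otimes> u = \<zero>" using assms by (simp add: n m_assoc m_comm[of i u])
  have "(u [^] n \<oplus> i [^] n) \<otimes> (u \<oplus> i) =
      u [^] n \<otimes> u \<oplus> i [^] n \<otimes> i \<oplus> (u [^] n \<otimes> i \<oplus> i [^] n \<otimes> u)"
    if "u [^] n \<in> carrier R" "i [^] n \<in> carrier R"
    using that assms(1,2) by algebra
  then show ?case using assms un ni step by simp
qed

lemma nilpotents_mult_eq_zero:
  assumes "\<one> \<noteq> \<zero>" and P: "powers_determine_annihilation R"
    and i: "i \<in> annihilator R (nilpotents R)" "i \<notin> nilpotents R"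
    and u: "u \<in> nilpotents R" and v: "v \<in> nilpotents R"
  shows "u \<otimes> v = \<zero>"
proof (cases "v = \<zero>")
  case True
  then show ?thesis using u by (auto simp: nilpotents_def)
next
  case False
  obtain k :: nat where k: "k \<ge> 1" "u [^] k = \<zero>" using u by (auto simp: nilpotents_def)
  have c: "u \<in> carrier R" "v \<in> carrier R" "i \<in> carrier R"
    using u v i by (auto simp: nilpotents_def annihilator_def)
  have ui: "u \<otimes> i = \<zero>" and vi: "v \<otimes> i = \<zero>"
    using i u v by (auto simp: annihilator_def)
  have pow: "(u \<oplus> i) [^] k = i [^] k"
    using add_pow_of_orthogonal[of u i k] c ui k by simp
  obtain l where l: "k = Suc l" using k by (cases k) auto
  have "(u \<oplus> i) [^] k \<otimes> v [^] (1::nat) = \<zero>"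
    unfolding pow using c vi by (simp add: l m_assoc m_comm[of i v])
  moreover have "(u \<oplus> i) [^] k \<noteq> \<zero>"
    unfolding pow using pow_nonzero_if_not_nilpotent assms(1) c i(2) by blast
  moreover have "u \<oplus> i \<noteq> v"
  proof
    assume "u \<oplus> i = v"
    moreover have "i = (u \<oplus> i) \<oplus> \<ominus> u" using c by algebra
    ultimately have "i \<in> nilpotents R" using nilpotents_add nilpotents_uminus u v by metis
    with i(2) show False by simp
  qed
  ultimately have "(u \<oplus> i) \<otimes> v = \<zero>"
    using powers_determine_annihilationD[OF P, of "u \<oplus> i" v k 1] False c by simp
  then show ?thesis using c vi by (simp add: l_distr m_comm[of i v])
qed

lemma mult_eq_zero_of_nilpotent_component:
  fixes n m :: nat
  assumes "\<one> \<noteq> \<zero>" and P: "powers_determine_annihilation R"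
    and I: "I \<subseteq> annihilator R (nilpotents R)"
    and nil2: "\<And>u v. u \<in> nilpotents R \<Longrightarrow> v \<in> nilpotents R \<Longrightarrow> u \<otimes> v = \<zero>"
    and x: "x \<in> nilpotents R" and y: "y \<in> carrier R" "y \<notin> nilpotents R"
    and i: "i \<in> I" and j: "j \<in> I"
    and xy: "x [^] n \<otimes> y [^] m = \<zero>" and xy': "(x \<oplus> i) [^] n \<otimes> (y \<oplus> j) [^] m = \<zero>"
    and nz: "x [^] n \<noteq> \<zero> \<or> (x \<oplus> i) [^] n \<noteq> \<zero>"
  shows "x \<otimes> y = \<zero>"
proof -
  have c: "x \<in> carrier R" "i \<in> carrier R" "j \<in> carrier R"
    using x i j I by (auto simp: nilpotents_def annihilator_def)
  have xi: "x \<otimes> i = \<zero>" and xj: "x \<otimes> j = \<zero>"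
    using x i j I by (auto simp: annihilator_def)
  have non_nil: "p [^] k \<noteq> \<zero>" if "p \<in> carrier R" "p \<notin> nilpotents R" for p and k :: nat
    using that pow_nonzero_if_not_nilpotent assms(1) by blast
  show ?thesis
  proof (cases "x [^] n = \<zero>")
    case False
    then show ?thesis
      using powers_determine_annihilationD[OF P c(1) y(1) _ xy] non_nil[OF y] x y by blast
  next
    case True
    with nz have x'n: "(x \<oplus> i) [^] n \<noteq> \<zero>" by simp
    then have n: "n \<ge> 1" using True by (cases n) auto
    have pow: "(x \<oplus> i) [^] n = i [^] n"
      using add_pow_of_orthogonal[OF c(1,2) xi n] True c by simp
    have eq: "x \<otimes> y = x \<otimes> (y \<oplus> j)"
      using c y xj by (simp add: r_distr)
    have "x \<otimes> (y \<oplus> j) = \<zero>"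
    proof (cases "y \<oplus> j \<in> nilpotents R")
      case True
      then show ?thesis using nil2 x by blast
    next
      case False
      then have y'm: "(y \<oplus> j) [^] m \<noteq> \<zero>" using non_nil c y by simp
      have y': "y \<oplus> j \<in> carrier R" using c y by simp
      have *: "p \<otimes> (y \<oplus> j) = \<zero>"
        if "p \<in> carrier R" "p [^] n = (x \<oplus> i) [^] n" for p
        using that y' False y'm x'n xy'
        by (metis powers_determine_annihilationD[OF P] nilpotentI_of_pow_mult assms(1))
      have "(x \<oplus> i) \<otimes> (y \<oplus> j) = \<zero>" "i \<otimes> (y \<oplus> j) = \<zero>"
        using * c pow by auto
      then show ?thesis
        using c y' by (simp add: l_distr)
    qed
    then show ?thesis using eq by simp
  qed
qed

lemma mult_eq_zero_of_component:
  fixes n m :: nat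
  assumes one: "\<one> \<noteq> \<zero>" and P: "powers_determine_annihilation R"
    and I: "I \<subseteq> annihilator R (nilpotents R)"
    and nil2: "\<And>u v. u \<in> nilpotents R \<Longrightarrow> v \<in> nilpotents R \<Longrightarrow> u \<otimes> v = \<zero>"
    and x: "x \<in> carrier R" and y: "y \<in> carrier R"
    and i: "i \<in> I" and j: "j \<in> I"
    and xy: "x [^] n \<otimes> y [^] m = \<zero>" and xy': "(x \<oplus> i) [^] n \<otimes> (y \<oplus> j) [^] m = \<zero>"
    and nzx: "x [^] n \<noteq> \<zero> \<or> (x \<oplus> i) [^] n \<noteq> \<zero>"
    and nzy: "y [^] m \<noteq> \<zero> \<or> (y \<oplus> j) [^] m \<noteq> \<zero>"
  shows "x \<otimes> y = \<zero>"
proof -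
  have c: "i \<in> carrier R" "j \<in> carrier R"
    using i j I by (auto simp: annihilator_def)
  consider "x \<in> nilpotents R" "y \<in> nilpotents R"
    | "x \<in> nilpotents R" "y \<notin> nilpotents R"
    | "x \<notin> nilpotents R" "y \<in> nilpotents R"
    | "x \<notin> nilpotents R" "y \<notin> nilpotents R" by blast
  then show ?thesis
  proof cases
    case 1
    then show ?thesis by (rule nil2)
  next
    case 2
    then show ?thesis
      using mult_eq_zero_of_nilpotent_component[OF one P I nil2 _ y _ i j xy xy' nzx] by blast
  next
    case 3
    have yx: "y [^] m \<otimes> x [^] n = \<zero>" "(y \<oplus> j) [^] m \<otimes> (x \<oplus> i) [^] n = \<zero>"
      using xy xy' x y c by (simp_all add: m_comm)
    have "y \<otimes> x = \<zero>"
      using mult_eq_zero_of_nilpotent_component[OF one P I nil2 _ x _ j i yx nzy] 3 by blast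
    then show ?thesis using x y by (simp add: m_comm)
  next
    case 4
    then have "x \<noteq> y" using nilpotentI_of_pow_mult[OF one x] xy by blast
    then show ?thesis
      using powers_determine_annihilationD[OF P x y _ xy] pow_nonzero_if_not_nilpotent[OF one]
        x y 4 by blast
  qed
qed

lemma carrier_duplication:
  "carrier (R \<Join> I) = {(r, r \<oplus> i) | r i. r \<in> carrier R \<and> i \<in> I}"
  by (simp add: amalgamated_duplication_def)

lemma duplication_ops:
  "\<zero>\<^bsub>R \<Join> I\<^esub> = (\<zero>, \<zero>)" "\<one>\<^bsub>R \<Join> I\<^esub> = (\<one>, \<one>)"
  "(a, b) \<otimes>\<^bsub>R \<Join> I\<^esub> (c, d) = (a \<otimes> c, b \<otimes> d)"
  by (simp_all add: amalgamated_duplication_def RDirProd_def DirProd_def monoid.defs)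

lemma duplication_pow: "(a, b) [^]\<^bsub>R \<Join> I\<^esub> (n::nat) = (a [^] n, b [^] n)"
  by (induction n) (simp_all add: nat_pow_def duplication_ops)

lemma cring_duplication:
  assumes "ideal I R"
  shows "cring (R \<Join> I)"
proof -
  interpret P: ring "RDirProd R R" by (rule RDirProd_ring) (rule ring_axioms)+
  have sub: "subcring (carrier (R \<Join> I)) (RDirProd R R)"
    using assms by (rule amalgamated_duplication_subcring)
  then have "carrier (R \<Join> I) \<subseteq> carrier (RDirProd R R)"
    by (intro subringE(1)[OF subcring.axioms(1)])
  from P.subcring_iff[OF this] sub
  have "cring ((RDirProd R R) \<lparr> carrier := carrier (R \<Join> I) \<rparr>)"
    by simp
  then show ?thesis by (simp add: amalgamated_duplication_def)
qed

lemma duplication_powers_determine_annihilation_imp: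
  assumes one: "\<one> \<noteq> \<zero>" and "ideal I R"
    and ex: "I - nilpotents R \<noteq> {}"
    and P: "powers_determine_annihilation (R \<Join> I)"
  shows "powers_determine_annihilation R" and "I \<subseteq> annihilator R (nilpotents R)"
proof -
  interpret I: ideal I R by fact
  have dup: "(a, a \<oplus> i) \<in> carrier (R \<Join> I)" if "a \<in> carrier R" "i \<in> I" for a i
    using that by (auto simp: carrier_duplication)
  have diag: "(a, a) \<in> carrier (R \<Join> I)" if "a \<in> carrier R" for a
    using dup[OF that I.zero_closed] that by simp
  show "powers_determine_annihilation R"
    unfolding powers_determine_annihilation_def
  proof (intro ballI allI impI)
    fix x y and n m :: nat
    assume "x \<in> carrier R" "y \<in> carrier R" "x \<noteq> y" "x [^] n \<otimes> y [^] m = \<zero>"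
      "x [^] n \<noteq> \<zero>" "y [^] m \<noteq> \<zero>"
    then show "x \<otimes> y = \<zero>"
      using powers_determine_annihilationD[OF P diag diag, of x y n m]
      by (simp add: duplication_ops duplication_pow)
  qed
  obtain i where i: "i \<in> I" "i \<notin> nilpotents R" using ex by blast
  show "I \<subseteq> annihilator R (nilpotents R)"
  proof
    fix a assume a: "a \<in> I"
    have "b \<otimes> a = \<zero>" if b: "b \<in> nilpotents R" for b
    proof (cases "a = \<zero>")
      case True
      then show ?thesis using b by (auto simp: nilpotents_def)
    next
      case False
      have c: "a \<in> carrier R" "b \<in> carrier R" "i \<in> carrier R"
        using a b i by (auto simp: nilpotents_def)
      have "i = (b \<oplus> i) \<oplus> \<ominus> b" using c by algebra
      then have "b \<oplus> i \<notin> nilpotents R"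
        using i b nilpotents_add nilpotents_uminus by metis
      then have nz: "(b \<oplus> i) [^] k \<noteq> \<zero>" for k :: nat
        using pow_nonzero_if_not_nilpotent[OF one] c by simp
      obtain k :: nat where k: "b [^] k = \<zero>" using b by (auto simp: nilpotents_def)
      have a0: "(a, \<zero>) \<in> carrier (R \<Join> I)"
        using dup[OF c(1) I.a_inv_closed[OF a]] c by (simp add: r_neg)
      have "(b, b \<oplus> i) \<noteq> (a, \<zero>)" using nz[of 1] c by simp
      then have "(b, b \<oplus> i) \<otimes>\<^bsub>R \<Join> I\<^esub> (a, \<zero>) = \<zero>\<^bsub>R \<Join> I\<^esub>"
        using powers_determine_annihilationD[OF P dup[OF c(2) i(1)] a0, of k 1] c k nz False
        by (simp add: duplication_ops duplication_pow)
      then show ?thesis by (simp add: duplication_ops)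
    qed
    then show "a \<in> annihilator R (nilpotents R)" using a by (simp add: annihilator_def)
  qed
qed

lemma duplication_powers_determine_annihilation:
  assumes one: "\<one> \<noteq> \<zero>" and "ideal I R"
    and ex: "I - nilpotents R \<noteq> {}"
    and P: "powers_determine_annihilation R" and I: "I \<subseteq> annihilator R (nilpotents R)"
  shows "powers_determine_annihilation (R \<Join> I)"
  unfolding powers_determine_annihilation_def
proof (intro ballI allI impI)
  interpret I: ideal I R by fact
  obtain e where e: "e \<in> I" "e \<notin> nilpotents R" using ex by blast
  have nil2: "u \<otimes> v = \<zero>" if "u \<in> nilpotents R" "v \<in> nilpotents R" for u v
    using nilpotents_mult_eq_zero[OF one P _ e(2) that] e(1) I by blast
  fix p q and n m :: nat
  assume p: "p \<in> carrier (R \<Join> I)" and q: "q \<in> carrier (R \<Join> I)"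
    and pq: "p [^]\<^bsub>R \<Join> I\<^esub> n \<otimes>\<^bsub>R \<Join> I\<^esub> q [^]\<^bsub>R \<Join> I\<^esub> m = \<zero>\<^bsub>R \<Join> I\<^esub>"
    and pn: "p [^]\<^bsub>R \<Join> I\<^esub> n \<noteq> \<zero>\<^bsub>R \<Join> I\<^esub>" and qm: "q [^]\<^bsub>R \<Join> I\<^esub> m \<noteq> \<zero>\<^bsub>R \<Join> I\<^esub>"
  obtain x i where x: "x \<in> carrier R" "i \<in> I" "p = (x, x \<oplus> i)"
    using p by (auto simp: carrier_duplication)
  obtain y j where y: "y \<in> carrier R" "j \<in> I" "q = (y, y \<oplus> j)"
    using q by (auto simp: carrier_duplication)
  have xy: "x [^] n \<otimes> y [^] m = \<zero>" and xy': "(x \<oplus> i) [^] n \<otimes> (y \<oplus> j) [^] m = \<zero>"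
    and nz: "x [^] n \<noteq> \<zero> \<or> (x \<oplus> i) [^] n \<noteq> \<zero>" "y [^] m \<noteq> \<zero> \<or> (y \<oplus> j) [^] m \<noteq> \<zero>"
    using pq pn qm by (auto simp: x y duplication_ops duplication_pow)
  have "x \<otimes> y = \<zero>"
    by (rule mult_eq_zero_of_component[OF one P I nil2 x(1) y(1) x(2) y(2) xy xy' nz])
  moreover have "(x \<oplus> i) \<otimes> (y \<oplus> j) = \<zero>"
  proof (rule mult_eq_zero_of_component[OF one P I nil2, where i = "\<ominus> i" and j = "\<ominus> j"])
    have "(x \<oplus> i) \<oplus> \<ominus> i = x" "(y \<oplus> j) \<oplus> \<ominus> j = y"
      using x y by (simp_all add: a_assoc r_neg)
    then show "((x \<oplus> i) \<oplus> \<ominus> i) [^] n \<otimes> ((y \<oplus> j) \<oplus> \<ominus> j) [^] m = \<zero>"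
      and "(x \<oplus> i) [^] n \<noteq> \<zero> \<or> ((x \<oplus> i) \<oplus> \<ominus> i) [^] n \<noteq> \<zero>"
      and "(y \<oplus> j) [^] m \<noteq> \<zero> \<or> ((y \<oplus> j) \<oplus> \<ominus> j) [^] m \<noteq> \<zero>"
      using xy nz by auto
  qed (use x y xy' in auto)
  ultimately show "p \<otimes>\<^bsub>R \<Join> I\<^esub> q = \<zero>\<^bsub>R \<Join> I\<^esub>"
    by (simp add: x y duplication_ops)
qed

end

theorem theorem2p3:
  fixes R :: "('a, 'b) ring_scheme" and I :: "'a set"
  assumes "cring R"
    and "\<one>\<^bsub>R\<^esub> \<noteq> \<zero>\<^bsub>R\<^esub>"
    and "ideal I R"
    and "I - nilpotents R \<noteq> {}"
  shows "extended_zero_divisor_graph (R \<Join> I) = zero_divisor_graph (R \<Join> I) \<longleftrightarrow>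
    extended_zero_divisor_graph R = zero_divisor_graph R \<and>
    I \<subseteq> annihilator R (nilpotents R)"
proof -
  interpret cring R by fact
  interpret D: cring "R \<Join> I" by (rule cring_duplication) fact
  show ?thesis
    unfolding graphs_eq_iff_powers_determine_annihilation
      D.graphs_eq_iff_powers_determine_annihilation
    using duplication_powers_determine_annihilation_imp[OF assms(2-4)]
      duplication_powers_determine_annihilation[OF assms(2-4)]
    by blast
qed

end
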